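(* Let $n\ge1$, $\delta>0$ and $\beta<n$. Suppose that $b$ is a function on $\mathbf{T}^n$ satisfying the $\gamma$-Hölder continuity condition with $\gamma>n/2$. Let $$u(x,t)=\hat b_0\frac{t^2}{2}+\sum_{0\ne k\in\mathbb{Z}^n}\frac{\hat b_k}{m_k}\left[\cos(\sqrt{-m_k}\,t)-1\right]e^{ik\cdot x}.$$ Then $u(x,\cdot)\in C^\infty[0,\infty)$ (in the sense of classical derivatives in $t$) for any $x\in\mathbf{T}^n$.
   Context: For $k\in\mathbb{Z}^n$, $m_k=m^{\delta,\beta}(k)$, where for $\nu\in\mathbb{R}^n$ $$m^{\delta,\beta}(\nu)=-\|\nu\|^2\,{}_2F_3\!\left(1,\tfrac{n+2-\beta}{2};2,\tfrac{n+2}{2},\tfrac{n+4-\beta}{2};-\tfrac14\|\nu\|^2\delta^2\right),$$ ${}_2F_3(a_1,a_2;b_1,b_2,b_3;z)=\sum_{j\ge0}\frac{(a_1)_j(a_2)_j}{(b_1)_j(b_2)_j(b_3)_j}\frac{z^j}{j!}$, $(a)_j=a(a+1)\cdots(a+j-1)$; one has $m_k<0$ for all $k\neq0$. $\mathbf{T}^n=\prod_{j=1}^n[0,2\pi]$ is the periodic torus, and functions on it are $2\pi$-periodic in each variable; $\hat b_k$ are the Fourier coefficients, $b=\sum_{k\in\mathbb{Z}^n}\hat b_ke^{ik\cdot x}$. A function $b$ satisfies the $\gamma$-Hölder continuity condition if there is a constant $C$ with $|b(x)-b(y)|\le C\|x-y\|^\gamma$ for all $x,y$ (for the periodic extension to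 $\mathbb{R}^n$). *)

theory Defs
  imports "HOL-Analysis.Analysis"
begin

definition hypergeom_2F3 :: "real \<Rightarrow> real \<Rightarrow> real \<Rightarrow> real \<Rightarrow> real \<Rightarrow> real \<Rightarrow> real" where
  "hypergeom_2F3 a1 a2 b1 b2 b3 z =
     (\<Sum>j. pochhammer a1 j * pochhammer a2 j /
           (pochhammer b1 j * pochhammer b2 j * pochhammer b3 j) * (z ^ j / fact j))"

definition multiplier :: "real \<Rightarrow> real \<Rightarrow> real ^ 'n \<Rightarrow> real" where
  "multiplier \<delta> \<beta> \<nu> =
     - (norm \<nu>)\<^sup>2 *
       hypergeom_2F3 1 ((real CARD('n) + 2 - \<beta>) / 2)
         2 ((real CARD('n) + 2) / 2) ((real CARD('n) + 4 - \<beta>) / 2)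
         (- (1 / 4) * (norm \<nu>)\<^sup>2 * \<delta>\<^sup>2)"

text \<open>The lattice of integer vectors is the type \<^typ>\<open>int ^ 'n\<close>, embedded into
  \<^typ>\<open>real ^ 'n\<close> as follows.\<close>

definition of_lattice :: "int ^ 'n \<Rightarrow> real ^ 'n" where
  "of_lattice k = (\<chi> i. of_int (k $ i))"

definition torus :: "(real ^ 'n) set" where
  "torus = {x. \<forall>i. 0 \<le> x $ i \<and> x $ i \<le> 2 * pi}"

text \<open>A function on the torus is represented by its periodic extension to the whole space.\<close>

definition torus_periodic :: "(real ^ 'n \<Rightarrow> 'a) \<Rightarrow> bool" where
  "torus_periodic b \<longleftrightarrow> (\<forall>x i. b (x + axis i (2 * pi)) = b x)"

definition Holder_continuous :: "real \<Rightarrow> ('a::real_normed_vector \<Rightarrow> 'b::real_normed_vector) \<Rightarrow> bool" where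
  "Holder_continuous \<gamma> b \<longleftrightarrow> (\<exists>C. \<forall>x y. norm (b x - b y) \<le> C * norm (x - y) powr \<gamma>)"

definition fourier_coeff :: "(real ^ 'n \<Rightarrow> complex) \<Rightarrow> int ^ 'n \<Rightarrow> complex" where
  "fourier_coeff b k =
     integral torus (\<lambda>x. b x * cis (- (of_lattice k \<bullet> x))) / (2 * of_real pi) ^ CARD('n)"

definition u_term :: "real \<Rightarrow> real \<Rightarrow> (real ^ 'n \<Rightarrow> complex) \<Rightarrow> real ^ 'n \<Rightarrow> real \<Rightarrow> int ^ 'n \<Rightarrow> complex" where
  "u_term \<delta> \<beta> b x t k =
     (let m = multiplier \<delta> \<beta> (of_lattice k)
      in fourier_coeff b k / of_real m * of_real (cos (sqrt (- m) * t) - 1) * cis (of_lattice k \<bullet> x))"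

text \<open>The infinite sum below defaults to 0 when the family is not summable, so statements about
  \<open>u_sol\<close> are to be accompanied by summability of \<open>u_term\<close>. On complex numbers this
  summability is absolute convergence of the series.\<close>

definition u_sol :: "real \<Rightarrow> real \<Rightarrow> (real ^ 'n \<Rightarrow> complex) \<Rightarrow> real ^ 'n \<Rightarrow> real \<Rightarrow> complex" where
  "u_sol \<delta> \<beta> b x t =
     fourier_coeff b 0 * of_real (t\<^sup>2 / 2) + (\<Sum>\<^sub>\<infinity>k\<in>- {0}. u_term \<delta> \<beta> b x t k)"

text \<open>Derivatives are taken within \<open>S\<close>, hence are one-sided at an endpoint of an interval \<open>S\<close>.\<close>

fun Ck_on :: "nat \<Rightarrow> real set \<Rightarrow> (real \<Rightarrow> 'a::real_normed_vector) \<Rightarrow> bool" where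
  "Ck_on 0 S f \<longleftrightarrow> continuous_on S f"
| "Ck_on (Suc j) S f \<longleftrightarrow>
     (\<exists>f'. (\<forall>t\<in>S. (f has_vector_derivative f' t) (at t within S)) \<and> Ck_on j S f')"

definition C_infinity_on :: "real set \<Rightarrow> (real \<Rightarrow> 'a::real_normed_vector) \<Rightarrow> bool" where
  "C_infinity_on S f \<longleftrightarrow> (\<forall>j. Ck_on j S f)"

end

theory Submission
  imports Defs
begin

text \<open>Writing \<open>\<alpha> = (n - \<beta>) / 2\<close>, \<open>s = \<parallel>\<nu>\<parallel>\<^sup>2 \<delta>\<^sup>2 / 4\<close> and \<open>G(s) = \<^sub>0F\<^sub>1(; n/2; - s)\<close>, the multiplier is an affine function of the
  weighted average \<open>\<integral>\<^sub>0\<^sup>1 t\<^sup>\<alpha>\<^sup>-\<^sup>1 G(s t) dt\<close>. Since \<open>G\<close> is bounded by an energy estimate for its differential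
  equation, \<open>m\<close> is bounded when \<open>\<beta> < n\<close>. Bernstein's dyadic argument gives \<open>\<Sum> \<bar>b\<^sub>k\<bar> < \<infinity>\<close>, and each \<open>t\<close>-derivative of
  order \<open>j + 2\<close> of the \<open>k\<close>-th term is at most \<open>\<bar>b\<^sub>k\<bar> \<bar>m\<^sub>k\<bar>\<^sup>j\<^sup>/\<^sup>2\<close>. The series may therefore be differentiated
  termwise any number of times.\<close>

subsection \<open>Boundedness of the multiplier\<close>

text \<open>Multiplication by \<open>x\<close> undoes the index shift in \<open>diffs\<close>, so a
  differential equation for a power series turns into an identity between coefficients of equal
  powers.\<close>

lemma powser_times_deriv:
  fixes a :: "nat \<Rightarrow> real"
  assumes "\<And>y. summable (\<lambda>n. a n * y ^ n)"
  shows "(\<lambda>n. real n * a n * x ^ n) sums (x * (\<Sum>n. diffs a n * x ^ n))"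
proof -
  have "summable (\<lambda>n. diffs a n * x ^ n)"
    by (rule termdiff_converges_all) (rule assms)
  from sums_mult[OF diffs_equiv[OF this], of x]
  have "(\<lambda>n. x * (real n * a n * x ^ (n - Suc 0))) sums (x * (\<Sum>n. diffs a n * x ^ n))" .
  moreover have "x * (real n * a n * x ^ (n - Suc 0)) = real n * a n * x ^ n" for n
    by (cases n) auto
  ultimately show ?thesis
    by simp
qed

text \<open>Coefficients of \<open>0F1(; c; - s)\<close>, which for positive \<open>s\<close> is the
  Bessel function of order \<open>c - 1\<close> at \<open>2 * sqrt s\<close>, up to a constant and a
  power of \<open>s\<close>.\<close>

definition bessel_coeff :: "real \<Rightarrow> nat \<Rightarrow> real" where
  "bessel_coeff c i = (-1) ^ i / (fact i * pochhammer c i)"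

lemma power_le_pochhammer:
  fixes c :: real
  assumes "c > 0"
  shows "c ^ i \<le> pochhammer c i"
proof (induction i)
  case (Suc i)
  have "c ^ i * c \<le> pochhammer c i * (c + real i)"
    using Suc assms by (intro mult_mono) (auto simp: pochhammer_nonneg)
  then show ?case
    by (simp add: pochhammer_Suc mult.commute)
qed simp

text \<open>As \<open>pochhammer c i\<close> is at least \<open>c ^ i\<close>, the exponential
  series at \<open>\<bar>y\<bar> / c\<close> is a majorant.\<close>

lemma summable_bessel:
  assumes "c > 0"
  shows "summable (\<lambda>i. bessel_coeff c i * y ^ i)"
proof (rule summable_comparison_test')
  show "summable (\<lambda>i. inverse (fact i) * (\<bar>y\<bar> / c) ^ i)"
    by (rule summable_exp)
  show "norm (bessel_coeff c i * y ^ i) \<le> inverse (fact i) * (\<bar>y\<bar> / c) ^ i" for i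
  proof -
    have "pochhammer c i > 0" "c ^ i > 0" using assms by (auto simp: pochhammer_pos)
    then have "1 / pochhammer c i \<le> 1 / c ^ i"
      using power_le_pochhammer[OF assms, of i] by (simp add: frac_le)
    then have "\<bar>y\<bar> ^ i / fact i * (1 / pochhammer c i) \<le> \<bar>y\<bar> ^ i / fact i * (1 / c ^ i)"
      by (rule mult_left_mono) auto
    then show ?thesis
      using \<open>pochhammer c i > 0\<close>
      by (simp add: bessel_coeff_def abs_mult power_abs power_divide divide_simps mult_ac)
  qed
qed

text \<open>This is the coefficient form of \<open>s G'' + c G' + G = 0\<close>.\<close>

lemma bessel_coeff_Suc:
  assumes "c > 0"
  shows "(real n + 1) * (real n + c) * bessel_coeff c (Suc n) = - bessel_coeff c n"
proof -
  have "pochhammer c n > 0" "c + real n > 0" using assms by (auto simp: pochhammer_pos add_pos_nonneg)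
  then show ?thesis
    by (simp add: bessel_coeff_def pochhammer_Suc divide_simps) (simp add: algebra_simps)
qed

text \<open>The power series solves \<open>s G'' + c G' + G = 0\<close>, so the energy \<open>G\<^sup>2 + s G'\<^sup>2\<close> has derivative
  \<open>(1 - 2 c) G'\<^sup>2\<close>.\<close>

lemma abs_bessel_le_1:
  assumes "c \<ge> 1 / 2" "s \<ge> 0"
  shows "\<bar>\<Sum>i. bessel_coeff c i * s ^ i\<bar> \<le> 1"
proof -
  define a where "a = bessel_coeff c"
  have c: "c > 0" using assms by simp
  have sm: "summable (\<lambda>i. a i * y ^ i)" for y
    unfolding a_def by (rule summable_bessel[OF c])
  have sm1: "summable (\<lambda>i. diffs a i * y ^ i)" for y
    by (rule termdiff_converges_all) (rule sm)
  define G where "G = (\<lambda>s. \<Sum>i. a i * s ^ i)"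
  define G1 where "G1 = (\<lambda>s. \<Sum>i. diffs a i * s ^ i)"
  define G2 where "G2 = (\<lambda>s. \<Sum>i. diffs (diffs a) i * s ^ i)"
  have dG: "(G has_real_derivative G1 s) (at s)" for s
    unfolding G_def G1_def by (rule termdiffs_strong_converges_everywhere[OF sm])
  have dG1: "(G1 has_real_derivative G2 s) (at s)" for s
    unfolding G2_def G1_def by (rule termdiffs_strong_converges_everywhere[OF sm1])
  have ode: "s * G2 s + c * G1 s + G s = 0" for s
  proof -
    have "(\<lambda>n. real n * diffs a n * s ^ n + c * (diffs a n * s ^ n) + a n * s ^ n)
        sums (s * G2 s + c * G1 s + G s)"
      unfolding G_def G1_def G2_def
      by (intro sums_add sums_mult powser_times_deriv sm1 summable_sums sm)
    moreover have "real n * diffs a n * s ^ n + c * (diffs a n * s ^ n) + a n * s ^ n = 0" for n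
    proof -
      have "real n * diffs a n * s ^ n + c * (diffs a n * s ^ n) + a n * s ^ n
          = ((real n + 1) * (real n + c) * a (Suc n) + a n) * s ^ n"
        by (simp add: diffs_def algebra_simps)
      then show ?thesis
        using bessel_coeff_Suc[OF c, of n] by (simp add: a_def)
    qed
    ultimately show ?thesis
      by (simp add: sums_unique2)
  qed
  define E where "E = (\<lambda>s. (G s)\<^sup>2 + s * (G1 s)\<^sup>2)"
  have dE: "(E has_real_derivative (1 - 2 * c) * (G1 s)\<^sup>2) (at s)" for s
  proof -
    have "(E has_real_derivative 2 * G s * G1 s + ((G1 s)\<^sup>2 + s * (2 * G1 s * G2 s))) (at s)"
      unfolding E_def by (rule derivative_eq_intros dG dG1 refl)+ auto
    \<comment> \<open>The last summand contains the left side of the differential equation and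
      vanishes; what remains is nonpositive because \<open>c \<ge> 1 / 2\<close>.\<close>
    moreover have "2 * G s * G1 s + ((G1 s)\<^sup>2 + s * (2 * G1 s * G2 s)) =
        (1 - 2 * c) * (G1 s)\<^sup>2 + 2 * G1 s * (s * G2 s + c * G1 s + G s)"
      by (simp add: algebra_simps power2_eq_square)
    ultimately show ?thesis
      by (simp add: ode)
  qed
  have "(G s)\<^sup>2 \<le> E s"
    using assms by (simp add: E_def)
  also have "E s \<le> E 0"
  proof (rule DERIV_nonpos_imp_nonincreasing[of 0 s E])
    show "\<exists>y. (E has_real_derivative y) (at x) \<and> y \<le> 0" for x
      using dE[of x] assms by (intro exI[of _ "(1 - 2 * c) * (G1 x)\<^sup>2"] conjI mult_nonpos_nonneg) auto
  qed (use assms in auto)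
  also have "E 0 = 1"
    unfolding E_def G_def powser_zero by (simp add: a_def bessel_coeff_def)
  finally have "(G s)\<^sup>2 \<le> 1"
    by simp
  then show ?thesis
    by (simp add: G_def a_def abs_square_le_1)
qed

text \<open>The series is \<open>H(s) = \<integral>\<^sub>0\<^sup>1 t\<^sup>\<alpha>\<^sup>-\<^sup>1 G(s t) dt\<close>; the integral is avoided through \<open>(s\<^sup>\<alpha> H)' = s\<^sup>\<alpha>\<^sup>-\<^sup>1 G\<close>.\<close>

lemma abs_bessel_average_le:
  assumes "c \<ge> 1 / 2" "\<alpha> > 0" "s \<ge> 0"
  shows "summable (\<lambda>i. bessel_coeff c i / (\<alpha> + real i) * s ^ i)"
    and "\<bar>\<Sum>i. bessel_coeff c i / (\<alpha> + real i) * s ^ i\<bar> \<le> 1 / \<alpha>"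
proof -
  define a where "a = (\<lambda>i. bessel_coeff c i / (\<alpha> + real i))"
  have c: "c > 0" using assms by simp
  have sm: "summable (\<lambda>i. a i * y ^ i)" for y
  proof (rule summable_comparison_test')
    show "summable (\<lambda>i. (1 / \<alpha>) * norm (bessel_coeff c i * y ^ i))"
    proof -
      have "summable (\<lambda>i. norm (bessel_coeff c i * y ^ i))"
        by (rule powser_insidea[of _ "\<bar>y\<bar> + 1"]) (auto intro: summable_bessel[OF c])
      then show ?thesis by (rule summable_mult)
    qed
    show "norm (a i * y ^ i) \<le> (1 / \<alpha>) * norm (bessel_coeff c i * y ^ i)" for i
    proof -
      have "1 / (\<alpha> + real i) \<le> 1 / \<alpha>" using assms by (simp add: frac_le)
      then have "1 / (\<alpha> + real i) * norm (bessel_coeff c i * y ^ i) \<le> 1 / \<alpha> * norm (bessel_coeff c i * y ^ i)"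
        by (rule mult_right_mono) auto
      then show ?thesis using assms by (simp add: a_def abs_mult)
    qed
  qed
  then show "summable (\<lambda>i. bessel_coeff c i / (\<alpha> + real i) * s ^ i)"
    by (simp add: a_def)
  define G where "G = (\<lambda>s. \<Sum>i. bessel_coeff c i * s ^ i)"
  define H where "H = (\<lambda>s. \<Sum>i. a i * s ^ i)"
  define H1 where "H1 = (\<lambda>s. \<Sum>i. diffs a i * s ^ i)"
  have dH: "(H has_real_derivative H1 s) (at s)" for s
    unfolding H_def H1_def by (rule termdiffs_strong_converges_everywhere[OF sm])
  \<comment> \<open>The operator \<open>s d/ds + \<alpha>\<close> multiplies the \<open>n\<close>-th
    term by \<open>\<alpha> + real n\<close>, which cancels the denominator of
    \<open>a n\<close>.\<close>
  have ode: "s * H1 s + \<alpha> * H s = G s" for s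
  proof -
    have "(\<lambda>n. real n * a n * s ^ n + \<alpha> * (a n * s ^ n)) sums (s * H1 s + \<alpha> * H s)"
      unfolding H_def H1_def
      by (intro sums_add sums_mult powser_times_deriv summable_sums sm)
    moreover have "real n * a n * s ^ n + \<alpha> * (a n * s ^ n) = bessel_coeff c n * s ^ n" for n
    proof -
      have "\<alpha> + real n > 0" using assms by simp
      have "real n * a n * s ^ n + \<alpha> * (a n * s ^ n) = (\<alpha> + real n) * a n * s ^ n"
        by (simp add: algebra_simps)
      then show ?thesis using \<open>\<alpha> + real n > 0\<close> by (simp add: a_def)
    qed
    ultimately show ?thesis
      by (simp add: G_def sums_iff)
  qed
  \<comment> \<open>The sign \<open>\<sigma>\<close> splits the bound on the absolute value into two
    one-sided bounds, each obtained by monotonicity.\<close>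
  have bound: "\<sigma> * H s \<le> 1 / \<alpha>" if \<sigma>: "\<sigma> = 1 \<or> \<sigma> = -1" for \<sigma>
  proof (cases "s = 0")
    case True
    have "H 0 = 1 / \<alpha>"
      unfolding H_def powser_zero by (simp add: a_def bessel_coeff_def)
    then show ?thesis using True that assms by (auto simp: field_simps)
  next
    case False
    then have s: "s > 0" using assms by simp
    \<comment> \<open>\<open>K 0 = 0\<close> because \<open>0 powr \<alpha> = 0\<close>, and
      \<open>K\<close> has derivative \<open>x powr (\<alpha> - 1) * (\<sigma> * G x - 1)\<close>,
      which is nonpositive since \<open>\<bar>G x\<bar> \<le> 1\<close>. The rule for open intervals
      is used because \<open>K\<close> need not be differentiable at 0 when
      \<open>\<alpha> < 1\<close>.\<close>
    define K where "K = (\<lambda>x. x powr \<alpha> * (\<sigma> * H x - 1 / \<alpha>))"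
    have "K s \<le> K 0"
    proof (rule DERIV_nonpos_imp_decreasing_open[of 0 s K])
      show "0 \<le> s" using s by simp
      show "\<exists>y. (K has_real_derivative y) (at x) \<and> y \<le> 0" if x: "0 < x" "x < s" for x
      proof (intro exI conjI)
        have "(K has_real_derivative
            \<alpha> * x powr (\<alpha> - 1) * (\<sigma> * H x - 1 / \<alpha>) + x powr \<alpha> * (\<sigma> * H1 x)) (at x)"
          unfolding K_def using x
          by (auto intro!: derivative_eq_intros dH simp: mult_ac)
        moreover have "x powr \<alpha> = x powr (\<alpha> - 1) * x"
          using x by (simp add: powr_diff)
        then have "\<alpha> * x powr (\<alpha> - 1) * (\<sigma> * H x - 1 / \<alpha>) + x powr \<alpha> * (\<sigma> * H1 x)
            = x powr (\<alpha> - 1) * (\<sigma> * (x * H1 x + \<alpha> * H x) - 1)"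
          using assms by (simp add: algebra_simps)
        ultimately show "(K has_real_derivative x powr (\<alpha> - 1) * (\<sigma> * G x - 1)) (at x)"
          by (simp add: ode)
        have "\<bar>G x\<bar> \<le> 1" unfolding G_def using assms x by (intro abs_bessel_le_1) auto
        then show "x powr (\<alpha> - 1) * (\<sigma> * G x - 1) \<le> 0"
          using \<sigma> by (intro mult_nonneg_nonpos) auto
      qed
      have cH: "continuous_on {0..s} H"
        by (meson DERIV_isCont continuous_at_imp_continuous_on dH)
      show "continuous_on {0..s} K"
        unfolding K_def by (intro continuous_intros continuous_on_powr' cH) (use assms in auto)
    qed
    then have "s powr \<alpha> * (\<sigma> * H s - 1 / \<alpha>) \<le> 0"
      by (simp add: K_def)
    then show ?thesis
      using s by (simp add: mult_le_0_iff)
  qed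
  from bound[of 1] bound[of "-1"]
  show "\<bar>\<Sum>i. bessel_coeff c i / (\<alpha> + real i) * s ^ i\<bar> \<le> 1 / \<alpha>"
    unfolding H_def a_def by linarith
qed

text \<open>The quotient of the Pochhammer symbols of \<open>\<alpha> + 1\<close> and
  \<open>\<alpha> + 2\<close> telescopes to \<open>(\<alpha> + 1) / (\<alpha> + 1 + j)\<close>, and
  those of 1 and 2 together with \<open>fact j\<close> leave \<open>1 / fact (j + 1)\<close>. Hence
  \<open>s\<close> times the \<open>j\<close>-th term is a multiple of term \<open>j + 1\<close> of
  the average, and only its zeroth term \<open>1 / \<alpha>\<close> is missing.\<close>

lemma hypergeom_eq_bessel_average:
  assumes "c \<ge> 1 / 2" "\<alpha> > 0" "s \<ge> 0"
  shows "s * hypergeom_2F3 1 (\<alpha> + 1) 2 (c + 1) (\<alpha> + 2) (- s) =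
    (\<alpha> + 1) * c * (1 / \<alpha> - (\<Sum>i. bessel_coeff c i / (\<alpha> + real i) * s ^ i))"
proof -
  define h where "h = (\<lambda>i. bessel_coeff c i / (\<alpha> + real i) * s ^ i)"
  define f where "f = (\<lambda>j. pochhammer 1 j * pochhammer (\<alpha> + 1) j /
           (pochhammer 2 j * pochhammer (c + 1) j * pochhammer (\<alpha> + 2) j) * ((- s) ^ j / fact j))"
  have sm: "summable h" unfolding h_def by (rule abs_bessel_average_le[OF assms])
  have tm: "s * f j = - ((\<alpha> + 1) * c) * h (Suc j)" for j
  proof -
    have pos: "pochhammer (\<alpha> + 2) j > 0" "pochhammer (\<alpha> + 1) j > 0" "pochhammer (c + 1) j > 0"
      "c > 0" "\<alpha> + 1 + real j > 0"
      using assms by (auto simp: pochhammer_pos)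
    have "pochhammer (\<alpha> + 1) (Suc j) = (\<alpha> + 1) * pochhammer (\<alpha> + 2) j"
      using pochhammer_rec[of "\<alpha> + 1" j] by (simp add: add.assoc)
    then have 1: "pochhammer (\<alpha> + 1) j / pochhammer (\<alpha> + 2) j = (\<alpha> + 1) / (\<alpha> + 1 + real j)"
      using pochhammer_Suc[of "\<alpha> + 1" j] pos by (simp add: field_simps)
    have 2: "pochhammer 2 j = (fact (Suc j) :: real)"
      using pochhammer_rec[of "1::real" j] pochhammer_fact[of "Suc j", where 'a = real] by simp
    have 3: "pochhammer 1 j = (fact j :: real)"
      by (simp add: pochhammer_fact)
    have 4: "pochhammer c (Suc j) = c * pochhammer (c + 1) j"
      by (rule pochhammer_rec)
    have "f j = (pochhammer (\<alpha> + 1) j / pochhammer (\<alpha> + 2) j) * (-s) ^ j / (fact (Suc j) * pochhammer (c + 1) j)"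
      unfolding f_def 2 3 by simp
    also have "\<dots> = (\<alpha> + 1) / (\<alpha> + 1 + real j) * (-s) ^ j / (fact (Suc j) * pochhammer (c + 1) j)"
      by (simp only: 1)
    finally have "s * f j = - ((\<alpha> + 1) / (\<alpha> + 1 + real j) * (-s) ^ Suc j / (fact (Suc j) * pochhammer (c + 1) j))"
      by simp
    also have "\<dots> = - ((\<alpha> + 1) * c) * h (Suc j)"
      unfolding h_def bessel_coeff_def 4 using pos
      by (simp add: power_minus[of s] ac_simps)
    finally show ?thesis .
  qed
  have "s * suminf f = (\<Sum>j. s * f j)"
  \<comment> \<open>Summability of \<open>f\<close> is obtained by dividing by \<open>s\<close>; for
    \<open>s = 0\<close> both sides are 0.\<close>
  proof (cases "s = 0")
    case False
    have "summable (\<lambda>j. s * f j)"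
      unfolding tm using sm by (intro summable_mult) (simp add: summable_Suc_iff)
    then have "summable f" using False by (rule summable_mult_D)
    then show ?thesis by (rule suminf_mult[symmetric])
  qed simp
  also have "\<dots> = - ((\<alpha> + 1) * c) * (\<Sum>j. h (Suc j))"
    unfolding tm using sm by (intro suminf_mult) (simp add: summable_Suc_iff)
  also have "(\<Sum>j. h (Suc j)) = suminf h - h 0"
    by (rule suminf_split_head[OF sm])
  also have "h 0 = 1 / \<alpha>"
    by (simp add: h_def bessel_coeff_def)
  finally show ?thesis
    unfolding hypergeom_2F3_def f_def[symmetric] h_def by (simp add: algebra_simps)
qed

text \<open>The factor \<open>s\<close> in the preceding identity absorbs the growing factor
  \<open>(norm \<nu>)\<^sup>2\<close> of the multiplier. The average is at most
  \<open>1 / \<alpha>\<close> in absolute value, so its difference from \<open>1 / \<alpha>\<close>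
  is at most \<open>2 / \<alpha>\<close>.\<close>

lemma multiplier_bounded:
  assumes "\<delta> > 0" "\<beta> < real CARD('n)"
  obtains W where "W \<ge> 0" "\<And>\<nu> :: real ^ 'n. \<bar>multiplier \<delta> \<beta> \<nu>\<bar> \<le> W"
proof -
  define \<alpha> c where "\<alpha> = (real CARD('n) - \<beta>) / 2" and "c = real CARD('n) / 2"
  have \<alpha>: "\<alpha> > 0" using assms by (simp add: \<alpha>_def)
  have "CARD('n) > 0" by (rule zero_less_card_finite)
  then have c: "c \<ge> 1 / 2" unfolding c_def by linarith
  define W where "W = 4 / \<delta>\<^sup>2 * ((\<alpha> + 1) * c * (2 / \<alpha>))"
  have "\<bar>multiplier \<delta> \<beta> \<nu>\<bar> \<le> W" for \<nu> :: "real ^ 'n"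
  proof -
    define s where "s = (norm \<nu>)\<^sup>2 * \<delta>\<^sup>2 / 4"
    have s: "s \<ge> 0" by (simp add: s_def)
    have "multiplier \<delta> \<beta> \<nu> = - (4 / \<delta>\<^sup>2) * (s * hypergeom_2F3 1 (\<alpha> + 1) 2 (c + 1) (\<alpha> + 2) (- s))"
    proof -
      have e: "(real CARD('n) + 2 - \<beta>) / 2 = \<alpha> + 1" "(real CARD('n) + 2) / 2 = c + 1"
        "(real CARD('n) + 4 - \<beta>) / 2 = \<alpha> + 2" "- (1 / 4) * (norm \<nu>)\<^sup>2 * \<delta>\<^sup>2 = - s"
        by (auto simp: \<alpha>_def c_def s_def field_simps)
      show ?thesis
        unfolding multiplier_def e using assms by (simp add: s_def)
    qed
    also have "\<bar>\<dots>\<bar> = 4 / \<delta>\<^sup>2 * ((\<alpha> + 1) * c *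
        \<bar>1 / \<alpha> - (\<Sum>i. bessel_coeff c i / (\<alpha> + real i) * s ^ i)\<bar>)"
      unfolding hypergeom_eq_bessel_average[OF c \<alpha> s] using \<alpha> c by (simp add: abs_mult)
    also have "\<dots> \<le> W"
      unfolding W_def using abs_bessel_average_le(2)[OF c \<alpha> s] \<alpha> c
      by (intro mult_left_mono) auto
    finally show ?thesis .
  qed
  moreover have "W \<ge> 0" using \<alpha> c by (simp add: W_def)
  ultimately show ?thesis using that by blast
qed

subsection \<open>Fourier coefficients of Hoelder functions\<close>

lemma torus_eq_cbox: "torus = cbox 0 (\<chi> i. 2 * pi)"
  by (auto simp: torus_def mem_box_cart)

lemma integral_torus_split:
  fixes f :: "real ^ 'n \<Rightarrow> complex"
  assumes "continuous_on UNIV f" "0 \<le> c" "c \<le> 2 * pi"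
  shows "integral torus f =
    integral (cbox 0 (\<chi> j. if j = i then c else 2 * pi)) f + integral (cbox (axis i c) (\<chi> j. 2 * pi)) f"
proof -
  have "f integrable_on torus"
    unfolding torus_eq_cbox
    by (intro integrable_continuous continuous_on_subset[OF assms(1)]) auto
  then have "integral torus f =
      integral (torus \<inter> {x. x \<bullet> axis i 1 \<le> c}) f + integral (torus \<inter> {x. x \<bullet> axis i 1 \<ge> c}) f"
    unfolding torus_eq_cbox by (intro integral_split) auto
  also have "torus \<inter> {x. x \<bullet> axis i 1 \<le> c} = cbox 0 (\<chi> j. if j = i then c else 2 * pi)"
  proof -
    have "x \<in> torus \<and> x $ i \<le> c \<longleftrightarrow> x \<in> cbox 0 (\<chi> j. if j = i then c else 2 * pi)" for x :: "real ^ 'n"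
    proof
      assume x: "x \<in> cbox 0 (\<chi> j. if j = i then c else 2 * pi)"
      have "0 \<le> x $ j \<and> x $ j \<le> (if j = i then c else 2 * pi)" for j
        using x by (simp add: mem_box_cart)
      then have le: "0 \<le> x $ j" "x $ j \<le> (if j = i then c else 2 * pi)" for j
        by blast+
      have "x $ i \<le> c"
        using le(2)[of i] by simp
      moreover have "x $ j \<le> 2 * pi" for j
        using le(2)[of j] assms(3) by (cases "j = i") simp_all
      ultimately show "x \<in> torus \<and> x $ i \<le> c"
        using le(1) by (simp add: torus_def)
    qed (simp add: torus_def mem_box_cart)
    then show ?thesis by (auto simp: inner_axis)
  qed
  also have "torus \<inter> {x. x \<bullet> axis i 1 \<ge> c} = cbox (axis i c) (\<chi> j. 2 * pi)"
  proof -
    have "x \<in> torus \<and> x $ i \<ge> c \<longleftrightarrow> x \<in> cbox (axis i c) (\<chi> j. 2 * pi)" for x :: "real ^ 'n"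
    proof
      assume x: "x \<in> cbox (axis i c) (\<chi> j. 2 * pi)"
      have "(if j = i then c else 0) \<le> x $ j \<and> x $ j \<le> 2 * pi" for j
        using x by (simp add: mem_box_cart axis_def)
      then have le: "(if j = i then c else 0) \<le> x $ j" "x $ j \<le> 2 * pi" for j
        by blast+
      have "c \<le> x $ i"
        using le(1)[of i] by simp
      moreover have "0 \<le> x $ j" for j
        using le(1)[of j] assms(2) by (cases "j = i") simp_all
      ultimately show "x \<in> torus \<and> x $ i \<ge> c"
        using le(2) by (simp add: torus_def)
    qed (simp add: torus_def mem_box_cart axis_def)
    then show ?thesis by (auto simp: inner_axis)
  qed
  finally show ?thesis .
qed

text \<open>Cut the torus where coordinate \<open>i\<close> equals \<open>2 * pi - h\<close>. The
  lower slab moves to coordinates between \<open>h\<close> and \<open>2 * pi\<close>; the upper one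
  leaves the torus, and periodicity brings it back to coordinates between 0 and \<open>h\<close>.
  The two images again fill the torus.\<close>

lemma integral_torus_shift:
  fixes f :: "real ^ 'n \<Rightarrow> complex"
  assumes cont: "continuous_on UNIV f" and per: "torus_periodic f" and h: "0 \<le> h" "h \<le> 2 * pi"
  shows "integral torus (\<lambda>x. f (x + axis i h)) = integral torus f"
proof -
  define U :: "real \<Rightarrow> real ^ 'n" where "U c = (\<chi> j. if j = i then c else 2 * pi)" for c
  define V :: "real ^ 'n" where "V = (\<chi> j. 2 * pi)"
  have cont': "continuous_on UNIV (\<lambda>x. f (x + axis i h))"
    by (intro continuous_on_compose2[OF cont] continuous_intros) auto
  have *: "f (x + axis i h) = f (x + axis i (h - 2 * pi))" for x
  proof -
    have "f (x + axis i (h - 2 * pi)) = f (x + axis i (h - 2 * pi) + axis i (2 * pi))"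
      using per by (simp add: torus_periodic_def)
    also have "axis i (h - 2 * pi) + axis i (2 * pi) = axis i h"
      by (simp add: vec_eq_iff axis_def)
    then have "x + axis i (h - 2 * pi) + axis i (2 * pi) = x + axis i h"
      by (simp add: add.assoc)
    finally show ?thesis by simp
  qed
  have "integral torus (\<lambda>x. f (x + axis i h)) =
      integral (cbox 0 (U (2 * pi - h))) (\<lambda>x. f (x + axis i h)) +
      integral (cbox (axis i (2 * pi - h)) V) (\<lambda>x. f (x + axis i h))"
    unfolding U_def V_def by (rule integral_torus_split[OF cont']) (use h in auto)
  also have "integral (cbox 0 (U (2 * pi - h))) (\<lambda>x. f (x + axis i h)) = integral (cbox (axis i h) V) f"
  proof -
    have "V - axis i h = U (2 * pi - h)"
      by (simp add: V_def U_def vec_eq_iff axis_def)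
    then show ?thesis
      using integral_shift_cbox[of "axis i h" "axis i h" V f] by simp
  qed
  also have "integral (cbox (axis i (2 * pi - h)) V) (\<lambda>x. f (x + axis i h)) = integral (cbox 0 (U h)) f"
  proof -
    have "U h - axis i (h - 2 * pi) = V" "- axis i (h - 2 * pi) = axis i (2 * pi - h)"
      by (simp_all add: V_def U_def vec_eq_iff axis_def)
    then show ?thesis
      unfolding * using integral_shift_cbox[of 0 "axis i (h - 2 * pi)" "U h" f] by simp
  qed
  also have "integral (cbox (axis i h) V) f + integral (cbox 0 (U h)) f = integral torus f"
    using integral_torus_split[OF cont h, of i] by (simp add: U_def V_def)
  finally show ?thesis .
qed

lemma of_lattice_inner_axis: "of_lattice k \<bullet> axis i h = of_int (k $ i) * h"
  by (simp add: inner_axis of_lattice_def)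

lemma of_lattice_diff: "of_lattice (k - l) = of_lattice k - of_lattice l"
  by (simp add: of_lattice_def vec_eq_iff)

lemma continuous_on_character:
  "continuous_on A (\<lambda>x. cis (of_lattice k \<bullet> x))" "continuous_on A (\<lambda>x. cis (- (of_lattice k \<bullet> x)))"
  by (intro continuous_intros)+

lemma torus_periodic_character:
  "torus_periodic (\<lambda>x. cis (of_lattice k \<bullet> x))" "torus_periodic (\<lambda>x. cis (- (of_lattice k \<bullet> x)))"
proof -
  have 1: "cis (2 * pi * of_int m) = 1" for m
    by (rule cis_multiple_2pi) auto
  have "cis (of_lattice k \<bullet> (x + axis i (2 * pi))) = cis (of_lattice k \<bullet> x)" for x i
    using 1[of "k $ i"] by (simp add: inner_add_right of_lattice_inner_axis cis_mult[symmetric] mult_ac)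
  then show "torus_periodic (\<lambda>x. cis (of_lattice k \<bullet> x))"
    by (simp add: torus_periodic_def)
  then show "torus_periodic (\<lambda>x. cis (- (of_lattice k \<bullet> x)))"
    by (simp add: torus_periodic_def flip: cis_cnj)
qed

lemma has_integral_fourier_coeff:
  fixes b :: "real ^ 'n \<Rightarrow> complex"
  assumes "continuous_on UNIV b"
  shows "((\<lambda>x. b x * cis (- (of_lattice k \<bullet> x))) has_integral
      (2 * of_real pi) ^ CARD('n) * fourier_coeff b k) torus"
proof -
  have "(\<lambda>x. b x * cis (- (of_lattice k \<bullet> x))) integrable_on torus"
    unfolding torus_eq_cbox
    by (intro integrable_continuous continuous_on_mult continuous_on_character continuous_on_subset[OF assms]) auto
  then show ?thesis
    by (simp add: fourier_coeff_def has_integral_iff)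
qed

lemma has_integral_torus_const: "((\<lambda>_ :: real ^ 'n. c) has_integral ((2 * pi) ^ CARD('n)) *\<^sub>R c) torus"
proof -
  have "cbox 0 (\<chi> i. 2 * pi) \<noteq> ({} :: (real ^ 'n) set)"
    by (simp add: interval_ne_empty_cart)
  then have "measure lborel (torus :: (real ^ 'n) set) = (2 * pi) ^ CARD('n)"
    unfolding torus_eq_cbox by (subst content_cbox_cart) auto
  then show ?thesis
    using has_integral_const[of c 0 "(\<chi> i. 2 * pi) :: real ^ 'n"] by (simp add: torus_eq_cbox)
qed

text \<open>The integrand \<open>F\<close> of the Fourier coefficient is periodic, so translating it
  leaves the integral unchanged; the translated character contributes the phase.\<close>

lemma fourier_coeff_shift:
  fixes b :: "real ^ 'n \<Rightarrow> complex"
  assumes "continuous_on UNIV b" "torus_periodic b" "0 \<le> h" "h \<le> 2 * pi"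
  shows "fourier_coeff (\<lambda>x. b (x + axis i h)) k = cis (of_int (k $ i) * h) * fourier_coeff b k"
proof -
  define F where "F = (\<lambda>x. b x * cis (- (of_lattice k \<bullet> x)))"
  have "torus_periodic F"
    using assms(2) torus_periodic_character(2)[of k] by (simp add: torus_periodic_def F_def)
  then have "integral torus (\<lambda>x. F (x + axis i h)) = integral torus F"
    unfolding F_def
    by (intro integral_torus_shift continuous_on_mult continuous_on_character assms)
  moreover have "b (x + axis i h) * cis (- (of_lattice k \<bullet> x)) = cis (of_int (k $ i) * h) * F (x + axis i h)" for x
    by (simp add: F_def inner_add_right of_lattice_inner_axis cis_mult mult_ac)
  ultimately have "integral torus (\<lambda>x. b (x + axis i h) * cis (- (of_lattice k \<bullet> x))) =
      cis (of_int (k $ i) * h) * integral torus F"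
    by simp
  then show ?thesis
    by (simp add: fourier_coeff_def F_def)
qed

text \<open>For \<open>k \<noteq> 0\<close>, a translation by
  \<open>h = pi / \<bar>k $ i\<bar>\<close> in a direction with \<open>k $ i \<noteq> 0\<close>
  changes the sign of the character, so its integral equals its own negative.\<close>

lemma has_integral_character:
  fixes k :: "int ^ 'n"
  shows "((\<lambda>x. cis (of_lattice k \<bullet> x)) has_integral (if k = 0 then (2 * of_real pi) ^ CARD('n) else 0)) torus"
proof (cases "k = 0")
  case True
  then have "of_lattice k = 0" by (simp add: of_lattice_def vec_eq_iff)
  then show ?thesis
    using has_integral_torus_const[of "1 :: complex", where 'n = 'n] True by (simp add: scaleR_conv_of_real)
next
  case False
  then obtain i where i: "k $ i \<noteq> 0" by (auto simp: vec_eq_iff)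
  define h where "h = pi / \<bar>of_int (k $ i)\<bar>"
  have "1 \<le> \<bar>real_of_int (k $ i)\<bar>" using i by linarith
  then have "h \<le> pi / 1" unfolding h_def by (intro divide_left_mono) auto
  then have h: "0 \<le> h" "h \<le> 2 * pi" using pi_gt_zero by (auto simp: h_def simp del: pi_gt_zero)
  have "of_int (k $ i) * h = pi \<or> of_int (k $ i) * h = - pi"
    using i by (auto simp: h_def abs_if)
  then have m: "cis (of_int (k $ i) * h) = - 1"
    by (auto simp flip: cis_cnj)
  have "integral torus (\<lambda>x. cis (of_lattice k \<bullet> (x + axis i h))) = integral torus (\<lambda>x. cis (of_lattice k \<bullet> x))"
    by (rule integral_torus_shift[OF continuous_on_character(1) torus_periodic_character(1) h])
  also have "(\<lambda>x. cis (of_lattice k \<bullet> (x + axis i h))) = (\<lambda>x. - cis (of_lattice k \<bullet> x))"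
    using m by (simp add: inner_add_right of_lattice_inner_axis cis_mult[symmetric])
  finally have "integral torus (\<lambda>x. cis (of_lattice k \<bullet> x)) = 0"
    by simp
  moreover have "(\<lambda>x. cis (of_lattice k \<bullet> x)) integrable_on torus"
    unfolding torus_eq_cbox by (intro integrable_continuous continuous_on_character)
  ultimately show ?thesis
    using False by (simp add: has_integral_iff)
qed

text \<open>With \<open>S\<close> the Fourier sum over \<open>F\<close>, the inequality
  \<open>0 \<le> |g - S|^2\<close> reads \<open>2 Re (g * cnj S) - |S|^2 \<le> |g|^2\<close>. By
  orthogonality the left side integrates to \<open>2 * V * N - V * N\<close>, and the right side is
  at most \<open>B^2\<close> pointwise.\<close>

lemma bessel_inequality:
  fixes g :: "real ^ 'n \<Rightarrow> complex"
  assumes cont: "continuous_on UNIV g" and bound: "\<And>x. norm (g x) \<le> B" and F: "finite F"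
  shows "(\<Sum>k\<in>F. (norm (fourier_coeff g k))\<^sup>2) \<le> B\<^sup>2"
proof -
  define V :: real where "V = (2 * pi) ^ CARD('n)"
  have V: "V > 0" by (simp add: V_def)
  define a where "a = fourier_coeff g"
  define S where "S = (\<lambda>x. \<Sum>l\<in>F. a l * cis (of_lattice l \<bullet> x))"
  have cnj_S: "cnj (S x) = (\<Sum>l\<in>F. cnj (a l) * cis (- (of_lattice l \<bullet> x)))" for x
    by (simp add: S_def cis_cnj)
  have gS: "((\<lambda>x. g x * cnj (S x)) has_integral (\<Sum>l\<in>F. cnj (a l) * (of_real V * a l))) torus"
  proof -
    have "((\<lambda>x. \<Sum>l\<in>F. cnj (a l) * (g x * cis (- (of_lattice l \<bullet> x)))) has_integral
        (\<Sum>l\<in>F. cnj (a l) * (of_real V * a l))) torus"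
      using has_integral_fourier_coeff[OF cont]
      by (intro has_integral_sum has_integral_mult_right F) (auto simp: a_def V_def)
    then show ?thesis
      by (simp add: cnj_S sum_distrib_left mult_ac)
  qed
  \<comment> \<open>Orthogonality leaves only the summand \<open>l = k\<close> of
    \<open>cnj (S x)\<close>.\<close>
  have eS: "((\<lambda>x. cis (of_lattice k \<bullet> x) * cnj (S x)) has_integral (of_real V * cnj (a k))) torus"
    if "k \<in> F" for k
  proof -
    have "((\<lambda>x. \<Sum>l\<in>F. cnj (a l) * cis (of_lattice (k - l) \<bullet> x)) has_integral
        (\<Sum>l\<in>F. cnj (a l) * (if k - l = 0 then (2 * of_real pi) ^ CARD('n) else 0))) torus"
      by (intro has_integral_sum has_integral_mult_right F has_integral_character)
    moreover have "(\<Sum>l\<in>F. cnj (a l) * (if k - l = 0 then (2 * of_real pi) ^ CARD('n) else 0)) =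
        (\<Sum>l\<in>F. if k = l then of_real V * cnj (a l) else 0)"
      by (intro sum.cong) (auto simp: V_def)
    then have "(\<Sum>l\<in>F. cnj (a l) * (if k - l = 0 then (2 * of_real pi) ^ CARD('n) else 0)) = of_real V * cnj (a k)"
      using that F by simp
    moreover have "cis (of_lattice k \<bullet> x) * cnj (S x) = (\<Sum>l\<in>F. cnj (a l) * cis (of_lattice (k - l) \<bullet> x))" for x
      unfolding cnj_S sum_distrib_left
      by (intro sum.cong refl) (simp add: of_lattice_diff inner_diff_left cis_mult)
    ultimately show ?thesis by simp
  qed
  have SS: "((\<lambda>x. S x * cnj (S x)) has_integral (\<Sum>l\<in>F. a l * (of_real V * cnj (a l)))) torus"
  proof -
    have "((\<lambda>x. \<Sum>l\<in>F. a l * (cis (of_lattice l \<bullet> x) * cnj (S x))) has_integral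
        (\<Sum>l\<in>F. a l * (of_real V * cnj (a l)))) torus"
      by (intro has_integral_sum has_integral_mult_right F eS)
    then show ?thesis
      by (simp add: S_def sum_distrib_right mult_ac)
  qed
  define N where "N = (\<Sum>k\<in>F. (norm (a k))\<^sup>2)"
  have N1: "(\<Sum>l\<in>F. a l * (of_real V * cnj (a l))) = of_real (V * N)"
    unfolding N_def of_real_mult of_real_sum sum_distrib_left
    by (intro sum.cong refl) (simp add: complex_norm_square mult_ac del: of_real_power)
  have N2: "(\<Sum>l\<in>F. cnj (a l) * (of_real V * a l)) = of_real (V * N)"
    unfolding N1[symmetric] by (simp add: mult_ac)
  have "((\<lambda>x. 2 * (g x * cnj (S x)) - S x * cnj (S x)) has_integral (2 * of_real (V * N) - of_real (V * N))) torus"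
    using gS SS unfolding N1 N2 by (intro has_integral_diff has_integral_mult_right)
  from has_integral_Re[OF this]
  have T: "((\<lambda>x. Re (2 * (g x * cnj (S x)) - S x * cnj (S x))) has_integral (V * N)) torus"
    by (simp del: of_real_mult minus_complex.sel times_complex.sel)
  have "Re (2 * (g x * cnj (S x)) - S x * cnj (S x)) \<le> B\<^sup>2" for x
  proof -
    have "0 \<le> (norm (g x - S x))\<^sup>2" by simp
    then have "Re (2 * (g x * cnj (S x)) - S x * cnj (S x)) \<le> (norm (g x))\<^sup>2"
      unfolding cmod_power2 by (simp add: power2_eq_square algebra_simps)
    also have "\<dots> \<le> B\<^sup>2"
      using bound by (intro power_mono) auto
    finally show ?thesis .
  qed
  then have "V * N \<le> V *\<^sub>R B\<^sup>2"
    using has_integral_torus_const[of "B\<^sup>2", where 'n = 'n] unfolding V_def[symmetric]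
    by (intro has_integral_le[OF T]) auto
  then show ?thesis
    using V by (simp add: N_def a_def)
qed

section \<open>Dyadic blocks of frequencies and Bernstein's estimate on one block\<close>

lemma card_vec:
  assumes "finite S"
  shows "finite {k :: 'a ^ 'n. \<forall>i. k $ i \<in> S}" "card {k :: 'a ^ 'n. \<forall>i. k $ i \<in> S} = card S ^ CARD('n)"
proof -
  have eq: "{k :: 'a ^ 'n. \<forall>i. k $ i \<in> S} = vec_lambda ` (PiE UNIV (\<lambda>_. S))"
  proof (intro set_eqI iffI)
    fix k :: "'a ^ 'n" assume "k \<in> {k. \<forall>i. k $ i \<in> S}"
    then show "k \<in> vec_lambda ` (PiE UNIV (\<lambda>_. S))"
      by (intro image_eqI[of _ _ "vec_nth k"]) auto
  qed auto
  show "finite {k :: 'a ^ 'n. \<forall>i. k $ i \<in> S}"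
    unfolding eq using assms by (intro finite_imageI finite_PiE) auto
  have "inj_on (vec_lambda :: ('n \<Rightarrow> 'a) \<Rightarrow> _) A" for A
    by (metis injI inj_on_subset subset_UNIV vec_lambda_inverse UNIV_I)
  then show "card {k :: 'a ^ 'n. \<forall>i. k $ i \<in> S} = card S ^ CARD('n)"
    unfolding eq by (simp add: card_image card_PiE)
qed

text \<open>The shell on which the maximum norm lies between \<open>2 ^ j\<close> and
  \<open>2 ^ Suc j\<close>. With this norm a single coordinate has the full size, and it selects the
  direction in which \<open>b\<close> is translated.\<close>

definition dyadic_block :: "nat \<Rightarrow> (int ^ 'n) set" where
  "dyadic_block j = {k. (\<forall>i. \<bar>k $ i\<bar> < 2 ^ Suc j) \<and> (\<exists>i. 2 ^ j \<le> \<bar>k $ i\<bar>)}"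

text \<open>The block lies in a cube with \<open>4 * 2 ^ j - 1\<close> admissible integers per
  coordinate.\<close>

lemma card_dyadic_block:
  shows "finite (dyadic_block j :: (int ^ 'n) set)"
    and "card (dyadic_block j :: (int ^ 'n) set) \<le> (4 * 2 ^ j) ^ CARD('n)"
proof -
  let ?S = "{- (2 ^ Suc j) <..< 2 ^ Suc j :: int}"
  let ?K = "{k :: int ^ 'n. \<forall>i. k $ i \<in> ?S}"
  have sub: "dyadic_block j \<subseteq> ?K"
    by (auto simp: dyadic_block_def abs_less_iff minus_less_iff)
  have fin: "finite ?K" and card: "card ?K = card ?S ^ CARD('n)"
    by (rule card_vec; simp)+
  show "finite (dyadic_block j :: (int ^ 'n) set)"
    by (rule finite_subset[OF sub fin])
  have "card ?S \<le> 4 * 2 ^ j"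
    by (simp add: nat_le_iff)
  then have "card ?S ^ CARD('n) \<le> (4 * 2 ^ j) ^ CARD('n)"
    by (rule power_mono) simp
  then show "card (dyadic_block j :: (int ^ 'n) set) \<le> (4 * 2 ^ j) ^ CARD('n)"
    using card_mono[OF fin sub] card by linarith
qed

text \<open>The index is the binary logarithm, rounded down, of the largest
  \<open>\<bar>k $ i\<bar>\<close>, which is at least 1.\<close>

lemma dyadic_block_cover:
  fixes k :: "int ^ 'n"
  assumes "k \<noteq> 0"
  obtains j where "k \<in> dyadic_block j"
proof -
  define M where "M = Max (range (\<lambda>i. nat \<bar>k $ i\<bar>))"
  have le: "nat \<bar>k $ i\<bar> \<le> M" for i
    unfolding M_def by (rule Max_ge) auto
  have "M \<in> range (\<lambda>i. nat \<bar>k $ i\<bar>)"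
    unfolding M_def by (rule Max_in) auto
  then obtain i0 where i0: "M = nat \<bar>k $ i0\<bar>" by auto
  obtain i1 where "k $ i1 \<noteq> 0" using assms by (auto simp: vec_eq_iff)
  then have "M \<ge> 1" using le[of i1] by linarith
  then obtain j where j: "2 ^ j \<le> M" "M < 2 ^ Suc j"
    using ex_power_ivl1[of 2 M] by auto
  have "int M < int (2 ^ Suc j)" "int (2 ^ j) \<le> int M"
    using j by (simp_all only: of_nat_less_iff of_nat_le_iff)
  then have j': "int M < 2 ^ Suc j" "2 ^ j \<le> int M"
    by simp_all
  have "\<bar>k $ i\<bar> \<le> int M" for i using le[of i] by linarith
  then have "k \<in> dyadic_block j"
    unfolding dyadic_block_def using j' i0 by (auto intro: le_less_trans)
  then show ?thesis by (rule that)
qed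

text \<open>The square equals \<open>2 - 2 * cos \<theta>\<close>, and the cosine is nonpositive on
  this range.\<close>

lemma norm_cis_minus_one_ge:
  assumes "pi / 2 \<le> \<bar>\<theta>\<bar>" "\<bar>\<theta>\<bar> \<le> pi"
  shows "2 \<le> (norm (cis \<theta> - 1))\<^sup>2"
proof -
  have "cos \<bar>\<theta>\<bar> \<le> cos (pi / 2)"
    using assms by (intro cos_monotone_0_pi_le) auto
  then have "cos \<theta> \<le> 0" by simp
  moreover have "(norm (cis \<theta> - 1))\<^sup>2 = ((cos \<theta>)\<^sup>2 + (sin \<theta>)\<^sup>2) + 1 - 2 * cos \<theta>"
    unfolding cmod_power2 by (simp add: power2_eq_square algebra_simps)
  ultimately show ?thesis by simp
qed

text \<open>Bernstein's argument: for \<open>2\<^sup>j \<le> \<bar>k\<^sub>i\<bar> < 2\<^sup>j\<^sup>+\<^sup>1\<close> and \<open>h = \<pi> / 2\<^sup>j\<^sup>+\<^sup>1\<close> the factor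
  \<open>\<bar>e\<^sup>i\<^sup>k\<^sup>h - 1\<bar>\<^sup>2\<close> in the Fourier coefficients of the increment of \<open>b\<close> in direction \<open>i\<close> is
  at least \<open>2\<close>.\<close>

lemma sum_square_fourier_coeff_block:
  fixes b :: "real ^ 'n \<Rightarrow> complex"
  assumes cont: "continuous_on UNIV b" and per: "torus_periodic b"
    and C: "\<And>x y. norm (b x - b y) \<le> C * norm (x - y) powr \<gamma>"
  shows "(\<Sum>k\<in>dyadic_block j. (norm (fourier_coeff b k))\<^sup>2) \<le>
    real CARD('n) / 2 * (C * (pi / 2 ^ Suc j) powr \<gamma>)\<^sup>2"
proof -
  define h where "h = pi / 2 ^ Suc j"
  have "h \<le> pi / 1" unfolding h_def by (intro divide_left_mono) (auto simp del: power_Suc)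
  then have h: "0 \<le> h" "h \<le> 2 * pi" using pi_gt_zero by (auto simp: h_def simp del: pi_gt_zero)
  let ?A = "dyadic_block j :: (int ^ 'n) set"
  let ?f = "\<lambda>i k. (norm (cis (of_int (k $ i) * h) - 1))\<^sup>2 * (norm (fourier_coeff b k))\<^sup>2"
  \<comment> \<open>Bessel's inequality is applied to the increment \<open>g\<close>: its Fourier
    coefficients carry the factor \<open>cis (of_int (k $ i) * h) - 1\<close>, and the Hoelder
    condition at distance \<open>h\<close> bounds it uniformly.\<close>
  have dir: "(\<Sum>k\<in>?A. ?f i k) \<le> (C * h powr \<gamma>)\<^sup>2" for i
  proof -
    define g where "g = (\<lambda>x. b (x + axis i h) - b x)"
    have cont': "continuous_on UNIV (\<lambda>x. b (x + axis i h))"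
      by (intro continuous_on_compose2[OF cont] continuous_intros) auto
    have "fourier_coeff g k = (cis (of_int (k $ i) * h) - 1) * fourier_coeff b k" for k
    proof -
      have "((\<lambda>x. g x * cis (- (of_lattice k \<bullet> x))) has_integral
        ((2 * of_real pi) ^ CARD('n) * fourier_coeff (\<lambda>x. b (x + axis i h)) k -
         (2 * of_real pi) ^ CARD('n) * fourier_coeff b k)) torus"
        unfolding g_def left_diff_distrib
        by (intro has_integral_diff has_integral_fourier_coeff cont cont')
      then show ?thesis
        unfolding fourier_coeff_def[of g] fourier_coeff_shift[OF cont per h]
        by (simp add: integral_unique field_simps)
    qed
    then have "(\<Sum>k\<in>?A. ?f i k) = (\<Sum>k\<in>?A. (norm (fourier_coeff g k))\<^sup>2)"
      by (simp add: norm_mult power_mult_distrib)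
    also have "\<dots> \<le> (C * h powr \<gamma>)\<^sup>2"
    proof (rule bessel_inequality)
      show "continuous_on UNIV g" unfolding g_def by (intro continuous_intros cont cont')
      show "norm (g x) \<le> C * h powr \<gamma>" for x
        using C[of "x + axis i h" x] h by (simp add: g_def norm_eq_sqrt_inner inner_axis_axis)
    qed (rule card_dyadic_block)
    finally show ?thesis .
  qed
  \<comment> \<open>The direction in which the factor is at least 2 depends on \<open>k\<close>.
    Summing over all directions removes this dependence at the cost of the factor
    \<open>CARD('n)\<close>.\<close>
  have "(\<Sum>k\<in>?A. (norm (fourier_coeff b k))\<^sup>2) \<le> (\<Sum>k\<in>?A. (1 / 2) * (\<Sum>i\<in>UNIV. ?f i k))"
  proof (rule sum_mono)
    fix k assume "k \<in> ?A"
    then obtain i where i: "2 ^ j \<le> \<bar>k $ i\<bar>" "\<bar>k $ i\<bar> < 2 ^ Suc j"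
      by (auto simp: dyadic_block_def)
    have "real_of_int (2 ^ j) \<le> real_of_int \<bar>k $ i\<bar>" "real_of_int \<bar>k $ i\<bar> \<le> real_of_int (2 ^ Suc j)"
      using i by (simp_all only: of_int_le_iff)
    then have i': "2 ^ j \<le> \<bar>real_of_int (k $ i)\<bar>" "\<bar>real_of_int (k $ i)\<bar> \<le> 2 ^ Suc j"
      by simp_all
    have "2 ^ j * h \<le> \<bar>real_of_int (k $ i)\<bar> * h" "\<bar>real_of_int (k $ i)\<bar> * h \<le> 2 ^ Suc j * h"
      using i' h by (auto intro!: mult_right_mono simp del: power_Suc)
    then have "pi / 2 \<le> \<bar>of_int (k $ i) * h\<bar>" "\<bar>of_int (k $ i) * h\<bar> \<le> pi"
      using h by (simp_all add: abs_mult) (simp_all add: h_def)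
    then have "2 * (norm (fourier_coeff b k))\<^sup>2 \<le> ?f i k"
      by (intro mult_right_mono norm_cis_minus_one_ge) auto
    also have "\<dots> \<le> (\<Sum>i\<in>UNIV. ?f i k)"
      by (rule member_le_sum) auto
    finally show "(norm (fourier_coeff b k))\<^sup>2 \<le> (1 / 2) * (\<Sum>i\<in>UNIV. ?f i k)"
      by simp
  qed
  also have "\<dots> = (1 / 2) * (\<Sum>i\<in>UNIV. \<Sum>k\<in>?A. ?f i k)"
    unfolding sum_distrib_left[symmetric] by (subst sum.swap) simp
  also have "\<dots> \<le> (1 / 2) * (\<Sum>i\<in>(UNIV :: 'n set). (C * h powr \<gamma>)\<^sup>2)"
    by (intro mult_left_mono sum_mono dir) auto
  finally show ?thesis
    by (simp add: h_def)
qed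

section \<open>Absolute summability of the Fourier coefficients\<close>

lemma Holder_continuousE:
  assumes "Holder_continuous \<gamma> b"
  obtains C where "C \<ge> 0" "\<And>x y. norm (b x - b y) \<le> C * norm (x - y) powr \<gamma>"
proof -
  obtain C where C: "\<And>x y. norm (b x - b y) \<le> C * norm (x - y) powr \<gamma>"
    using assms by (auto simp: Holder_continuous_def)
  have "norm (b x - b y) \<le> \<bar>C\<bar> * norm (x - y) powr \<gamma>" for x y
    by (rule order_trans[OF C]) (intro mult_right_mono, auto)
  then show ?thesis using that[of "\<bar>C\<bar>"] by auto
qed

lemma Holder_continuous_imp_continuous:
  assumes "Holder_continuous \<gamma> b" "\<gamma> > 0"
  shows "continuous_on UNIV b"
proof -
  obtain C where C: "C \<ge> 0" "\<And>x y. norm (b x - b y) \<le> C * norm (x - y) powr \<gamma>"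
    using Holder_continuousE[OF assms(1)] by blast
  have "(b \<longlongrightarrow> b x) (at x)" for x
  proof (rule Lim_null[THEN iffD2], rule Lim_null_comparison)
    show "eventually (\<lambda>y. norm (b y - b x) \<le> C * norm (y - x) powr \<gamma>) (at x)"
      using C by simp
    have "((\<lambda>y. C * norm (y - x) powr \<gamma>) \<longlongrightarrow> C * norm (x - x) powr \<gamma>) (at x)"
      using assms by (intro tendsto_intros tendsto_powr') auto
    then show "((\<lambda>y. C * norm (y - x) powr \<gamma>) \<longlongrightarrow> 0) (at x)"
      by simp
  qed
  then show ?thesis by (simp add: continuous_on_def)
qed

text \<open>On block \<open>j\<close>, Cauchy-Schwarz combines a cardinality of order
  \<open>2 ^ (j * n)\<close> with a square sum of order \<open>2 powr (- 2 * j * \<gamma>)\<close>.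
  The block sums therefore decay geometrically with ratio \<open>2 powr (n / 2 - \<gamma>)\<close>,
  which is below 1.\<close>

lemma fourier_coeff_abs_summable:
  fixes b :: "real ^ 'n \<Rightarrow> complex"
  assumes per: "torus_periodic b" and \<gamma>: "\<gamma> > real CARD('n) / 2" and hol: "Holder_continuous \<gamma> b"
  shows "(\<lambda>k. norm (fourier_coeff b k)) summable_on - {0}"
proof -
  have "\<gamma> > 0" using \<gamma> by (smt (verit) divide_nonneg_pos of_nat_0_le_iff)
  then have cont: "continuous_on UNIV b"
    by (rule Holder_continuous_imp_continuous[OF hol])
  obtain C where C: "C \<ge> 0" "\<And>x y. norm (b x - b y) \<le> C * norm (x - y) powr \<gamma>"
    using Holder_continuousE[OF hol] by blast
  \<comment> \<open>\<open>K\<close> and \<open>r\<close> are chosen so that the Cauchy-Schwarz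
    bound for block \<open>j\<close> is exactly \<open>(K * r ^ j)\<^sup>2\<close>.\<close>
  define K where "K = sqrt (4 ^ CARD('n) * (real CARD('n) / 2)) * C * (pi / 2) powr \<gamma>"
  define r where "r = 2 powr (real CARD('n) / 2 - \<gamma>)"
  have r: "0 < r" "r < 1"
    using \<gamma> by (auto simp: r_def powr_less_one)
  have K: "K \<ge> 0" using C by (simp add: K_def)
  define a where "a = (\<lambda>k. norm (fourier_coeff b k))"
  have a: "a k \<ge> 0" for k by (simp add: a_def)
  have block: "sum a (dyadic_block j) \<le> K * r ^ j" for j
  proof (rule power2_le_imp_le)
    have "(\<Sum>k\<in>dyadic_block j. 1 * a k)\<^sup>2 \<le> (\<Sum>k\<in>(dyadic_block j :: (int ^ 'n) set). 1\<^sup>2) * (\<Sum>k\<in>dyadic_block j. (a k)\<^sup>2)"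
      by (rule Cauchy_Schwarz_ineq_sum)
    also have "\<dots> \<le> (4 * 2 ^ j) ^ CARD('n) * (real CARD('n) / 2 * (C * (pi / 2 ^ Suc j) powr \<gamma>)\<^sup>2)"
    proof (rule mult_mono)
      have "real (card (dyadic_block j :: (int ^ 'n) set)) \<le> real ((4 * 2 ^ j) ^ CARD('n))"
        using card_dyadic_block(2) by (simp only: of_nat_le_iff)
      then show "(\<Sum>k\<in>(dyadic_block j :: (int ^ 'n) set). 1\<^sup>2) \<le> (4 * 2 ^ j :: real) ^ CARD('n)"
        by simp
      show "(\<Sum>k\<in>dyadic_block j. (a k)\<^sup>2) \<le> real CARD('n) / 2 * (C * (pi / 2 ^ Suc j) powr \<gamma>)\<^sup>2"
        unfolding a_def by (rule sum_square_fourier_coeff_block[OF cont per C(2)])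
    qed (auto intro: sum_nonneg)
    also have "\<dots> = (K * r ^ j)\<^sup>2"
    proof -
      have "(2 ^ j :: real) ^ CARD('n) = (2 powr real j) powr real CARD('n)"
        by (simp add: powr_realpow)
      moreover have "(pi / 2 ^ Suc j) powr \<gamma> = (pi / 2) powr \<gamma> * (2 powr real j) powr (- \<gamma>)"
        by (simp add: powr_divide powr_minus_divide powr_mult powr_realpow)
      moreover have "r ^ j = (2 powr real j) powr (real CARD('n) / 2 - \<gamma>)"
        by (simp add: r_def powr_powr mult.commute flip: powr_realpow)
      moreover have "((2 powr real j) powr (real CARD('n) / 2 - \<gamma>))\<^sup>2 =
          (2 powr real j) powr real CARD('n) * ((2 powr real j) powr (- \<gamma>))\<^sup>2"
        by (simp add: powr_powr power2_eq_square algebra_simps flip: powr_add)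
      ultimately show ?thesis
        by (simp add: K_def power_mult_distrib mult_ac)
    qed
    finally show "(sum a (dyadic_block j))\<^sup>2 \<le> (K * r ^ j)\<^sup>2"
      by simp
  qed (use K r in auto)
  show ?thesis
    unfolding a_def[symmetric]
  proof (rule nonneg_bdd_above_summable_on)
    show "bdd_above (sum a ` {F. F \<subseteq> - {0} \<and> finite F})"
    proof (rule bdd_aboveI2)
      fix F :: "(int ^ 'n) set" assume "F \<in> {F. F \<subseteq> - {0} \<and> finite F}"
      then have F: "F \<subseteq> - {0}" "finite F" by auto
      have "\<exists>j. k \<in> dyadic_block j" if "k \<in> F" for k
        using dyadic_block_cover[of k] that F by auto
      \<comment> \<open>Grouping a finite \<open>F\<close> by a chosen block index bounds its sum by
        the geometric series, independently of \<open>F\<close>.\<close>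
      then obtain J where J: "\<And>k. k \<in> F \<Longrightarrow> k \<in> dyadic_block (J k)"
        by metis
      have fJ: "finite (J ` F)" using F by simp
      have "sum a F = (\<Sum>j\<in>J ` F. sum a {k \<in> F. J k = j})"
        by (rule sum.image_gen[OF F(2)])
      also have "\<dots> \<le> (\<Sum>j\<in>J ` F. sum a (dyadic_block j))"
      proof (intro sum_mono sum_mono2 card_dyadic_block(1))
        show "{k \<in> F. J k = j} \<subseteq> dyadic_block j" for j
          using J by auto
      qed (rule a)
      also have "\<dots> \<le> (\<Sum>j\<in>J ` F. K * r ^ j)"
        by (intro sum_mono block)
      also have "\<dots> \<le> (\<Sum>j. K * r ^ j)"
        using r K fJ by (intro sum_le_suminf summable_mult summable_geometric) auto
      finally show "sum a F \<le> (\<Sum>j. K * r ^ j)" .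
    qed
  qed (rule a)
qed

subsection \<open>Termwise differentiation\<close>

text \<open>One sequence of successive derivatives supplies all witnesses in \<open>Ck_on\<close>.
  The induction keeps the starting index \<open>j\<close> arbitrary, because each step passes from
  \<open>F j\<close> to \<open>F (Suc j)\<close>.\<close>

lemma C_infinity_onI:
  assumes "\<And>j t. t \<in> S \<Longrightarrow> (F j has_vector_derivative F (Suc j) t) (at t within S)"
  shows "C_infinity_on S (F 0)"
proof -
  have "Ck_on m S (F j)" for m j
  proof (induction m arbitrary: j)
    case 0
    have "continuous (at t within S) (F j)" if "t \<in> S" for t
      using assms[OF that] by (rule has_vector_derivative_continuous)
    then show ?case by (simp add: continuous_on_eq_continuous_within)
  next
    case (Suc m)
    then show ?case using assms by auto
  qed
  then show ?thesis by (simp add: C_infinity_on_def)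
qed

lemma norm_diff_le_of_vector_derivative_bound:
  fixes f :: "real \<Rightarrow> 'a::real_normed_vector"
  assumes "\<And>t. (f has_vector_derivative f' t) (at t)" "\<And>t. norm (f' t) \<le> B"
  shows "norm (f s - f t) \<le> B * \<bar>s - t\<bar>"
proof -
  have "norm (f s - f t) \<le> B * norm (s - t)"
  proof (rule differentiable_bound[of UNIV f "\<lambda>t h. h *\<^sub>R f' t"])
    show "(f has_derivative (\<lambda>h. h *\<^sub>R f' t)) (at t within UNIV)" for t
      using assms(1)[of t] by (simp add: has_vector_derivative_def)
    show "onorm (\<lambda>h. h *\<^sub>R f' t) \<le> B" for t
      using assms(2)[of t] by (intro onorm_bound) (auto simp: mult.commute[of B] intro: mult_left_mono order_trans[OF norm_ge_zero])
  qed auto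
  then show ?thesis by simp
qed

text \<open>The bound on \<open>f'' k\<close> makes \<open>f' k\<close> Lipschitz with constant
  \<open>c k\<close>, so the linearization error of \<open>f k\<close> is at most
  \<open>\<bar>s - t\<bar>\<^sup>2 * c k\<close>. Summing over \<open>k\<close> keeps the error
  quadratic in \<open>s - t\<close>.\<close>

lemma has_vector_derivative_infsum:
  fixes f :: "'k \<Rightarrow> real \<Rightarrow> 'a::banach"
  assumes f: "\<And>k t. k \<in> A \<Longrightarrow> (f k has_vector_derivative f' k t) (at t)"
    and f': "\<And>k t. k \<in> A \<Longrightarrow> (f' k has_vector_derivative f'' k t) (at t)"
    and bound: "\<And>k t. k \<in> A \<Longrightarrow> norm (f'' k t) \<le> c k"
    and c: "c summable_on A"
    and sf: "\<And>t. (\<lambda>k. f k t) summable_on A" and sf': "\<And>t. (\<lambda>k. f' k t) summable_on A"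
  shows "((\<lambda>t. \<Sum>\<^sub>\<infinity>k\<in>A. f k t) has_vector_derivative (\<Sum>\<^sub>\<infinity>k\<in>A. f' k t)) (at t)"
proof -
  define M where "M = (\<Sum>\<^sub>\<infinity>k\<in>A. c k)"
  have c0: "c k \<ge> 0" if "k \<in> A" for k
    using bound[OF that, of 0] norm_ge_zero[of "f'' k 0"] by linarith
  have M: "M \<ge> 0" unfolding M_def by (rule infsum_nonneg) (rule c0)
  have term_bound: "norm (f k s - f k t - (s - t) *\<^sub>R f' k t) \<le> \<bar>s - t\<bar>\<^sup>2 * c k" if k: "k \<in> A" for k s
  proof -
    have "norm (f k s - f k t - (s - t) *\<^sub>R f' k t) \<le> norm (s - t) * (c k * \<bar>s - t\<bar>)"
    proof (rule vector_differentiable_bound_linearization[of "closed_segment t s"])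
      show "(f k has_vector_derivative f' k x) (at x within closed_segment t s)" for x
        using f[OF k] by (rule has_vector_derivative_at_within)
      fix x assume "x \<in> closed_segment t s"
      then have "\<bar>x - t\<bar> \<le> \<bar>s - t\<bar>" by (auto simp: closed_segment_eq_real_ivl split: if_splits)
      then have "c k * \<bar>x - t\<bar> \<le> c k * \<bar>s - t\<bar>" using c0[OF k] by (rule mult_left_mono)
      then show "norm (f' k x - f' k t) \<le> c k * \<bar>s - t\<bar>"
        using norm_diff_le_of_vector_derivative_bound[of "f' k" "f'' k" "c k" x t] f'[OF k] bound[OF k]
        by fastforce
    qed auto
    then show ?thesis by (simp add: power2_eq_square mult_ac)
  qed
  have main: "norm ((\<Sum>\<^sub>\<infinity>k\<in>A. f k s) - (\<Sum>\<^sub>\<infinity>k\<in>A. f k t) - (s - t) *\<^sub>R (\<Sum>\<^sub>\<infinity>k\<in>A. f' k t)) \<le> \<bar>s - t\<bar>\<^sup>2 * M" for s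
  proof -
    have sc: "(\<lambda>k. \<bar>s - t\<bar>\<^sup>2 * c k) summable_on A" by (rule summable_on_cmult_right[OF c])
    have abs: "(\<lambda>k. norm (f k s - f k t - (s - t) *\<^sub>R f' k t)) summable_on A"
      by (rule Infinite_Sum.abs_summable_on_comparison_test'[OF sc]) (rule term_bound)
    have "((\<lambda>k. f k s - f k t - (s - t) *\<^sub>R f' k t) has_sum
        (\<Sum>\<^sub>\<infinity>k\<in>A. f k s) - (\<Sum>\<^sub>\<infinity>k\<in>A. f k t) - (s - t) *\<^sub>R (\<Sum>\<^sub>\<infinity>k\<in>A. f' k t)) A"
    proof -
      have "((\<lambda>k. f k s + - f k t + - ((s - t) *\<^sub>R f' k t)) has_sum
          (\<Sum>\<^sub>\<infinity>k\<in>A. f k s) + - (\<Sum>\<^sub>\<infinity>k\<in>A. f k t) + - ((s - t) *\<^sub>R (\<Sum>\<^sub>\<infinity>k\<in>A. f' k t))) A"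
        by (intro has_sum_add has_sum_uminus[THEN iffD2]; simp add: has_sum_scaleR has_sum_infsum sf sf')
      then show ?thesis by simp
    qed
    then have "(\<Sum>\<^sub>\<infinity>k\<in>A. f k s) - (\<Sum>\<^sub>\<infinity>k\<in>A. f k t) - (s - t) *\<^sub>R (\<Sum>\<^sub>\<infinity>k\<in>A. f' k t) =
        (\<Sum>\<^sub>\<infinity>k\<in>A. f k s - f k t - (s - t) *\<^sub>R f' k t)"
      by (rule infsumI[symmetric])
    also have "norm \<dots> \<le> (\<Sum>\<^sub>\<infinity>k\<in>A. norm (f k s - f k t - (s - t) *\<^sub>R f' k t))"
      by (rule norm_infsum_bound[OF abs])
    also have "\<dots> \<le> (\<Sum>\<^sub>\<infinity>k\<in>A. \<bar>s - t\<bar>\<^sup>2 * c k)"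
      by (rule infsum_mono[OF abs sc term_bound])
    finally show ?thesis by (simp add: M_def infsum_cmult_right[OF c])
  qed
  show ?thesis
    unfolding has_vector_derivative_def has_derivative_within_alt
  proof (intro conjI allI impI)
    show "bounded_linear (\<lambda>x. x *\<^sub>R (\<Sum>\<^sub>\<infinity>k\<in>A. f' k t))" by (rule bounded_linear_scaleR_left)
    fix e :: real assume e: "e > 0"
    show "\<exists>d>0. \<forall>s\<in>UNIV. norm (s - t) < d \<longrightarrow>
      norm ((\<Sum>\<^sub>\<infinity>k\<in>A. f k s) - (\<Sum>\<^sub>\<infinity>k\<in>A. f k t) - (s - t) *\<^sub>R (\<Sum>\<^sub>\<infinity>k\<in>A. f' k t)) \<le> e * norm (s - t)"
    \<comment> \<open>The added 1 keeps the radius well defined when \<open>M = 0\<close>.\<close>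
    proof (intro exI[of _ "e / (M + 1)"] conjI ballI impI)
      show "0 < e / (M + 1)" using e M by simp
      fix s assume "norm (s - t) < e / (M + 1)"
      then have "\<bar>s - t\<bar> * (M + 1) \<le> e" using M by (simp add: field_simps)
      then have "\<bar>s - t\<bar> * M \<le> e" using M by (smt (verit) mult_left_mono abs_ge_zero)
      then have "\<bar>s - t\<bar> * (\<bar>s - t\<bar> * M) \<le> \<bar>s - t\<bar> * e" by (rule mult_left_mono) auto
      then have "\<bar>s - t\<bar>\<^sup>2 * M \<le> e * norm (s - t)" by (simp add: power2_eq_square mult_ac)
      then show "norm ((\<Sum>\<^sub>\<infinity>k\<in>A. f k s) - (\<Sum>\<^sub>\<infinity>k\<in>A. f k t) - (s - t) *\<^sub>R (\<Sum>\<^sub>\<infinity>k\<in>A. f' k t)) \<le> e * norm (s - t)"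
        using main[of s] by linarith
    qed
  qed
qed

text \<open>Only derivatives of order at least two are bounded by a summable family uniformly in \<open>t\<close>;
  the terms and their first derivatives are controlled because they vanish at \<open>0\<close>.\<close>

lemma infsum_smooth:
  fixes D :: "nat \<Rightarrow> 'k \<Rightarrow> real \<Rightarrow> 'a::banach"
  assumes D: "\<And>j k t. k \<in> A \<Longrightarrow> (D j k has_vector_derivative D (Suc j) k t) (at t)"
    and bound: "\<And>j k t. k \<in> A \<Longrightarrow> norm (D (j + 2) k t) \<le> c j k"
    and c: "\<And>j. c j summable_on A"
    and zero: "\<And>k. k \<in> A \<Longrightarrow> D 0 k 0 = 0" "\<And>k. k \<in> A \<Longrightarrow> D 1 k 0 = 0"
  shows "(\<lambda>k. D j k t) summable_on A"
    and "((\<lambda>t. \<Sum>\<^sub>\<infinity>k\<in>A. D j k t) has_vector_derivative (\<Sum>\<^sub>\<infinity>k\<in>A. D (Suc j) k t)) (at t)"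
proof -
  have summable_of_bound: "(\<lambda>k. D j k t) summable_on A"
    if "\<And>k. k \<in> A \<Longrightarrow> norm (D j k t) \<le> C * c m k" for j t C m
    by (rule abs_summable_summable, rule Infinite_Sum.abs_summable_on_comparison_test'[OF summable_on_cmult_right[OF c]])
      (rule that)
  have D1: "norm (D 1 k t) \<le> c 0 k * \<bar>t\<bar>" if k: "k \<in> A" for k t
  proof -
    have "norm (D 1 k t - D 1 k 0) \<le> c 0 k * \<bar>t - 0\<bar>"
    proof (rule norm_diff_le_of_vector_derivative_bound)
      show "(D 1 k has_vector_derivative D (0 + 2) k t) (at t)" for t
        using D[OF k, of 1] by (simp add: numeral_2_eq_2)
      show "norm (D (0 + 2) k t) \<le> c 0 k" for t by (rule bound[OF k])
    qed
    then show ?thesis using zero(2)[OF k] by simp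
  qed
  \<comment> \<open>The linearization of \<open>D 0 k\<close> at 0 is zero, so the Lipschitz bound
    for \<open>D 1 k\<close> gives quadratic growth in \<open>t\<close> with the summable factor
    \<open>c 0 k\<close>.\<close>
  have D0: "norm (D 0 k t) \<le> \<bar>t\<bar>\<^sup>2 * c 0 k" if k: "k \<in> A" for k t
  proof -
    have c0: "c 0 k \<ge> 0" using bound[OF k, of 0 0] norm_ge_zero order_trans by blast
    have "norm (D 0 k t - D 0 k 0 - (t - 0) *\<^sub>R D 1 k 0) \<le> norm (t - 0) * (c 0 k * \<bar>t\<bar>)"
    proof (rule vector_differentiable_bound_linearization[of "closed_segment 0 t"])
      show "(D 0 k has_vector_derivative D 1 k x) (at x within closed_segment 0 t)" for x
        using D[OF k, of 0] by (auto intro: has_vector_derivative_at_within)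
      fix x assume "x \<in> closed_segment 0 t"
      then have "\<bar>x\<bar> \<le> \<bar>t\<bar>" by (auto simp: closed_segment_eq_real_ivl split: if_splits)
      then have "c 0 k * \<bar>x\<bar> \<le> c 0 k * \<bar>t\<bar>" using c0 by (rule mult_left_mono)
      then show "norm (D 1 k x - D 1 k 0) \<le> c 0 k * \<bar>t\<bar>"
        using D1[OF k, of x] zero(2)[OF k] by simp
    qed auto
    then show ?thesis using zero[OF k] by (simp add: power2_eq_square mult_ac)
  qed
  show *: "(\<lambda>k. D j k t) summable_on A" for j t
  proof -
    consider "j = 0" | "j = 1" | m where "j = m + 2"
      by (metis One_nat_def add_2_eq_Suc' not0_implies_Suc)
    then show ?thesis
    proof cases
      case 1 then show ?thesis using D0 by (intro summable_of_bound[of 0 t "\<bar>t\<bar>\<^sup>2" 0, folded 1]) auto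
    next
      case 2 then show ?thesis using D1 by (intro summable_of_bound[of j t "\<bar>t\<bar>" 0]) (auto simp: mult.commute)
    next
      case 3 then show ?thesis using bound by (intro summable_of_bound[of j t 1 m]) auto
    qed
  qed
  show "((\<lambda>t. \<Sum>\<^sub>\<infinity>k\<in>A. D j k t) has_vector_derivative (\<Sum>\<^sub>\<infinity>k\<in>A. D (Suc j) k t)) (at t)"
  proof (rule has_vector_derivative_infsum)
    show "(D j k has_vector_derivative D (Suc j) k t) (at t)" if "k \<in> A" for k t
      by (rule D[OF that])
    show "(D (Suc j) k has_vector_derivative D (j + 2) k t) (at t)" if "k \<in> A" for k t
      using D[OF that, of "Suc j"] by simp
    show "norm (D (j + 2) k t) \<le> c j k" if "k \<in> A" for k t
      by (rule bound[OF that])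
  qed (rule c * )+
qed

text \<open>Writing each derivative as a phase shift by \<open>pi / 2\<close> gives one formula for
  all orders; the constant \<open>c\<close> accommodates the \<open>- 1\<close> present at order
  0.\<close>

lemma has_real_derivative_cos_shifted:
  "((\<lambda>t. \<omega> ^ j * cos (\<omega> * t + real j * (pi / 2)) - c) has_real_derivative
    \<omega> ^ Suc j * cos (\<omega> * t + real (Suc j) * (pi / 2))) (at t)"
proof -
  have "cos (\<omega> * t + real (Suc j) * (pi / 2)) = - sin (\<omega> * t + real j * (pi / 2))"
    using cos_add[of "\<omega> * t + real j * (pi / 2)" "pi / 2"]
    by (simp add: algebra_simps add_divide_distrib)
  then show ?thesis
    by (auto intro!: derivative_eq_intros)
qed

theorem theorem21:
  fixes b :: "real ^ 'n \<Rightarrow> complex" and \<delta> \<beta> \<gamma> :: real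
  assumes "\<delta> > 0"
    and "\<beta> < real CARD('n)"
    and "torus_periodic b"
    and "\<gamma> > real CARD('n) / 2"
    and "Holder_continuous \<gamma> b"
  shows "\<forall>x\<in>torus. (\<forall>t\<ge>0. u_term \<delta> \<beta> b x t summable_on - {0}) \<and>
           C_infinity_on {0..} (u_sol \<delta> \<beta> b x)"
proof
  fix x :: "real ^ 'n" assume "x \<in> torus"
  obtain W where W: "W \<ge> 0" "\<And>\<nu> :: real ^ 'n. \<bar>multiplier \<delta> \<beta> \<nu>\<bar> \<le> W"
    using multiplier_bounded[OF assms(1,2)] by blast
  define m where "m k = multiplier \<delta> \<beta> (of_lattice k :: real ^ 'n)" for k
  define \<omega> where "\<omega> k = sqrt (- m k)" for k
  \<comment> \<open>\<open>sqrt\<close> is extended as an odd function to negative arguments, so the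
    identity holds for either sign of \<open>m k\<close>.\<close>
  have \<omega>: "\<bar>\<omega> k\<bar>\<^sup>2 = \<bar>m k\<bar>" for k
    by (simp add: \<omega>_def power2_eq_square)
  define a where "a k = fourier_coeff b k / of_real (m k) * cis (of_lattice k \<bullet> x)" for k
  define d where "d j k t = \<omega> k ^ j * cos (\<omega> k * t + real j * (pi / 2)) - (if j = 0 then 1 else 0)" for j k t
  define D where "D j k t = d j k t *\<^sub>R a k" for j k t
  have D0: "D 0 k t = u_term \<delta> \<beta> b x t k" for k t
    by (simp add: D_def d_def a_def u_term_def Let_def m_def \<omega>_def scaleR_conv_of_real)
  have deriv: "(D j k has_vector_derivative D (Suc j) k t) (at t)" for j k t
  proof -
    have "(d j k has_real_derivative d (Suc j) k t) (at t)"
      using has_real_derivative_cos_shifted[of "\<omega> k" j] by (simp add: d_def[abs_def])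
    from has_vector_derivative_scaleR[OF this has_vector_derivative_const]
    show ?thesis by (simp add: D_def[abs_def])
  qed
  have bound: "norm (D (j + 2) k t) \<le> sqrt W ^ j * norm (fourier_coeff b k)" for j k t
  proof -
    have "\<bar>\<omega> k\<bar>\<^sup>2 \<le> W" unfolding \<omega> m_def by (rule W(2))
    then have \<omega>W: "\<bar>\<omega> k\<bar> \<le> sqrt W" by (rule real_le_rsqrt)
    have "d (j + 2) k t = \<omega> k ^ (j + 2) * cos (\<omega> k * t + real (j + 2) * (pi / 2))"
      by (simp add: d_def)
    then have "\<bar>d (j + 2) k t\<bar> = \<bar>\<omega> k\<bar> ^ (j + 2) * \<bar>cos (\<omega> k * t + real (j + 2) * (pi / 2))\<bar>"
      by (simp only: abs_mult power_abs)
    also have "\<dots> \<le> \<bar>\<omega> k\<bar> ^ (j + 2) * 1"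
      by (intro mult_left_mono) auto
    finally have "\<bar>d (j + 2) k t\<bar> \<le> \<bar>\<omega> k\<bar> ^ (j + 2)"
      by simp
    then have "norm (D (j + 2) k t) \<le> \<bar>\<omega> k\<bar> ^ (j + 2) * norm (a k)"
      by (auto simp: D_def intro: mult_right_mono)
    also have "\<dots> = \<bar>\<omega> k\<bar> ^ j * (\<bar>m k\<bar> * norm (a k))"
      unfolding power_add \<omega> by (simp add: mult.assoc)
    \<comment> \<open>The factor \<open>\<bar>m k\<bar>\<close> split off from the power cancels the
      denominator in \<open>a k\<close>; if \<open>m k = 0\<close>, division by zero makes
      \<open>a k = 0\<close> and the inequality remains true.\<close>
    also have "\<dots> \<le> sqrt W ^ j * norm (fourier_coeff b k)"
      using \<omega>W W(1) by (intro mult_mono power_mono) (auto simp: a_def norm_mult norm_divide)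
    finally show ?thesis .
  qed
  have c: "(\<lambda>k. sqrt W ^ j * norm (fourier_coeff b k)) summable_on - {0}" for j
    by (intro summable_on_cmult_right fourier_coeff_abs_summable[OF assms(3-5)])
  have zero: "D 0 k 0 = 0" "D 1 k 0 = 0" for k
    by (simp_all add: D_def d_def)
  have summable: "(\<lambda>k. D j k t) summable_on - {0}" for j t
    by (rule infsum_smooth(1)[OF deriv bound c zero])
  have smooth: "((\<lambda>t. \<Sum>\<^sub>\<infinity>k\<in>- {0}. D j k t) has_vector_derivative (\<Sum>\<^sub>\<infinity>k\<in>- {0}. D (Suc j) k t)) (at t)" for j t
    by (rule infsum_smooth(2)[OF deriv bound c zero])
  \<comment> \<open>The successive derivatives of \<open>t\<^sup>2 / 2\<close>, for the zero
    mode.\<close>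
  define p :: "nat \<Rightarrow> real \<Rightarrow> real" where
    "p j t = (if j = 0 then t\<^sup>2 / 2 else if j = 1 then t else if j = 2 then 1 else 0)" for j t
  have p: "(p j has_real_derivative p (Suc j) t) (at t)" for j t
  proof -
    consider "j = 0" | "j = 1" | "j = 2" | "j > 2" by linarith
    then show ?thesis
      by cases (auto simp: p_def[abs_def] intro!: derivative_eq_intros)
  qed
  define F where "F j t = p j t *\<^sub>R fourier_coeff b 0 + (\<Sum>\<^sub>\<infinity>k\<in>- {0}. D j k t)" for j t
  have F: "(F j has_vector_derivative F (Suc j) t) (at t)" for j t
    using has_vector_derivative_add[OF has_vector_derivative_scaleR[OF p has_vector_derivative_const] smooth]
    by (simp add: F_def[abs_def])
  have "u_sol \<delta> \<beta> b x = F 0"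
    by (simp add: fun_eq_iff u_sol_def F_def D0 p_def scaleR_conv_of_real mult.commute)
  moreover have "C_infinity_on {0..} (F 0)"
    \<comment> \<open>The derivatives exist on the whole line, so their restriction provides the
      one-sided derivative at 0.\<close>
    by (rule C_infinity_onI) (rule has_vector_derivative_at_within[OF F])
  moreover have "u_term \<delta> \<beta> b x t summable_on - {0}" for t
    using summable[of 0 t] by (simp add: D0)
  ultimately show "(\<forall>t\<ge>0. u_term \<delta> \<beta> b x t summable_on - {0}) \<and> C_infinity_on {0..} (u_sol \<delta> \<beta> b x)"
    by simp
qed

end
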